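(* Every affine impartial form $G\in\mathbb{Im}^\infty$ equals, modulo $\mathbb{Im}^\infty$, either a nimber $*n$ or the moon, i.e. the game $\{\infty\,|\,\overline{\infty}\}$.
   Context: Affine normal play forms $\mathbb{Np}^\infty$ are built recursively from two terminating games $\infty$ (Left wins; outcome $\mathscr{L}$) and $\overline{\infty}$ (Right wins; outcome $\mathscr{R}$), with $\infty+X=\infty$ for $X\neq\overline{\infty}$ and $\overline{\infty}+X=\overline{\infty}$ for $X\neq\infty$; the normal play zero is $0=\{\overline{\infty}\,|\,\infty\}$. A form $G\notin\{\infty,\overline{\infty}\}$ is a Left-check if $\infty$ is a Left option (Right-check if $\overline{\infty}$ is a Right option); it is quiet if it is neither $\infty,\overline{\infty}$ nor a check. The conjugate $\overline{G}$ swaps the roles of the players (swapping $\infty$ and $\overline{\infty}$). $G$ is symmetric if $G\notin\{\infty,\overline{\infty}\}$ and its Right options are exactly the conjugates of its Left options. $G$ is affine impartial ($G\in\mathbb{Im}^\infty$) if $G$ and all its quiet followers are symmetric. For $G,H\in\mathbb{Im}^\infty$, $G=_{\mathbb{Im}^\infty}H$ means $o(G+X)=o(H+X)$ for every $X\in\mathbb{Im}^\infty$, where $o$ denotes the outcome class among $\mathscr{L},\mathscr{N},\mathscr{P},\mathscr{R}$. *)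

theory Defs
  imports Main "HOL-Library.FSet"
begin

text \<open>Option sets are finite (short games), so that every nimber value is a natural number.
  Nonemptiness of the option sets is imposed by the set \<open>Np_inf\<close> below: the only terminal games
  are the two infinities, and a player without a proper move is modelled by a move to the
  infinity favouring the opponent, as in \<open>zero_game\<close>.\<close>

datatype game =
    PInf  ("\<infinity>")
  | NInf  ("\<infinity>\<^sub>R")
  | Form (left_opts: "game fset") (right_opts: "game fset")
where
  "left_opts PInf = {||}" | "right_opts PInf = {||}"
| "left_opts NInf = {||}" | "right_opts NInf = {||}"

lemma size_member_fset [termination_simp]:
  fixes z :: game
  assumes "z |\<in>| A"
  shows "size z < Suc ((\<Sum>x\<in>fset A. Suc (size x)) + c)"
    and "size z < Suc (c + (\<Sum>x\<in>fset A. Suc (size x)))"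
proof -
  have "Suc (size z) \<le> (\<Sum>x\<in>fset A. Suc (size x))"
    by (rule member_le_sum [of z _ "\<lambda>x. Suc (size x)"]) (use assms in auto)
  then show "size z < Suc ((\<Sum>x\<in>fset A. Suc (size x)) + c)"
    and "size z < Suc (c + (\<Sum>x\<in>fset A. Suc (size x)))"
    by auto
qed

inductive_set Np_inf :: "game set" where
  PInf: "\<infinity> \<in> Np_inf"
| NInf: "\<infinity>\<^sub>R \<in> Np_inf"
| Form: "\<lbrakk>GL \<noteq> {||}; GR \<noteq> {||}; \<And>g. g |\<in>| GL \<Longrightarrow> g \<in> Np_inf; \<And>g. g |\<in>| GR \<Longrightarrow> g \<in> Np_inf\<rbrakk>
    \<Longrightarrow> Form GL GR \<in> Np_inf"

text \<open>The sum of the two opposite infinities is not defined; it never arises as a follower of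
  \<open>plus_game G H\<close> when at most one of \<open>G\<close>, \<open>H\<close> is an infinity.\<close>

fun plus_game :: "game \<Rightarrow> game \<Rightarrow> game" where
  "plus_game \<infinity> \<infinity>\<^sub>R = undefined"
| "plus_game \<infinity>\<^sub>R \<infinity> = undefined"
| "plus_game \<infinity> X = \<infinity>"
| "plus_game X \<infinity> = \<infinity>"
| "plus_game \<infinity>\<^sub>R X = \<infinity>\<^sub>R"
| "plus_game X \<infinity>\<^sub>R = \<infinity>\<^sub>R"
| "plus_game (Form GL GR) (Form HL HR) =
     Form ((\<lambda>g. plus_game g (Form HL HR)) |`| GL |\<union>| (\<lambda>h. plus_game (Form GL GR) h) |`| HL)
          ((\<lambda>g. plus_game g (Form HL HR)) |`| GR |\<union>| (\<lambda>h. plus_game (Form GL GR) h) |`| HR)"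

fun conjugate :: "game \<Rightarrow> game" where
  "conjugate \<infinity> = \<infinity>\<^sub>R"
| "conjugate \<infinity>\<^sub>R = \<infinity>"
| "conjugate (Form GL GR) = Form (conjugate |`| GR) (conjugate |`| GL)"

fun left_wins_first :: "game \<Rightarrow> bool"
  and right_wins_first :: "game \<Rightarrow> bool" where
  "left_wins_first \<infinity> = True"
| "left_wins_first \<infinity>\<^sub>R = False"
| "left_wins_first (Form GL GR) = (\<exists>g |\<in>| GL. \<not> right_wins_first g)"
| "right_wins_first \<infinity> = False"
| "right_wins_first \<infinity>\<^sub>R = True"
| "right_wins_first (Form GL GR) = (\<exists>g |\<in>| GR. \<not> left_wins_first g)"

datatype outcome_class = \<L> | \<N> | \<P> | \<R>

definition outcome :: "game \<Rightarrow> outcome_class" where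
  "outcome G =
    (if left_wins_first G then (if right_wins_first G then \<N> else \<L>)
     else (if right_wins_first G then \<R> else \<P>))"

definition left_check :: "game \<Rightarrow> bool" where
  "left_check G \<longleftrightarrow> G \<notin> {\<infinity>, \<infinity>\<^sub>R} \<and> \<infinity> |\<in>| left_opts G"

definition right_check :: "game \<Rightarrow> bool" where
  "right_check G \<longleftrightarrow> G \<notin> {\<infinity>, \<infinity>\<^sub>R} \<and> \<infinity>\<^sub>R |\<in>| right_opts G"

definition quiet :: "game \<Rightarrow> bool" where
  "quiet G \<longleftrightarrow> G \<notin> {\<infinity>, \<infinity>\<^sub>R} \<and> \<not> left_check G \<and> \<not> right_check G"

definition symmetric :: "game \<Rightarrow> bool" where
  "symmetric G \<longleftrightarrow> G \<notin> {\<infinity>, \<infinity>\<^sub>R} \<and> right_opts G = conjugate |`| left_opts G"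

text \<open>Followers are reached by any sequence of moves, not necessarily alternating, including the
  empty one.\<close>

inductive follower :: "game \<Rightarrow> game \<Rightarrow> bool" for G where
  self: "follower G G"
| left: "\<lbrakk>follower G H; K |\<in>| left_opts H\<rbrakk> \<Longrightarrow> follower G K"
| right: "\<lbrakk>follower G H; K |\<in>| right_opts H\<rbrakk> \<Longrightarrow> follower G K"

definition Im_inf :: "game set" where
  "Im_inf = {G \<in> Np_inf. symmetric G \<and> (\<forall>H. follower G H \<and> quiet H \<longrightarrow> symmetric H)}"

definition eq_Im_inf :: "game \<Rightarrow> game \<Rightarrow> bool"  (infix "=\<^sub>I\<^sub>m" 50) where
  "G =\<^sub>I\<^sub>m H \<longleftrightarrow> (\<forall>X \<in> Im_inf. outcome (plus_game G X) = outcome (plus_game H X))"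

definition zero_game :: game where
  "zero_game = Form {|\<infinity>\<^sub>R|} {|\<infinity>|}"

declare fset_of_list_elem [termination_simp]

fun nimber :: "nat \<Rightarrow> game" where
  "nimber n =
    (if n = 0 then zero_game
     else Form (nimber |`| fset_of_list [0..<n]) (nimber |`| fset_of_list [0..<n]))"

declare nimber.simps [simp del]

definition moon :: game where
  "moon = Form {|\<infinity>|} {|\<infinity>\<^sub>R|}"

end

theory Submission imports Defs Complex_Main begin

text \<open>If \<open>X\<close> is quiet, then an entailing sequence of checks started in the other component \<open>H\<close>
  of \<open>H + X\<close> has to be answered inside \<open>H\<close>, until \<open>H\<close> is again quiet, hence symmetric. By
  induction, \<open>X\<close> therefore acts on \<open>H\<close> only through the nimbers \<open>*n\<close> for which \<open>X + *n\<close> is a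
  \<open>\<P>\<close>-position. There is at most one such \<open>n\<close>. If it exists, then \<open>X\<close> acts like \<open>*n\<close>; otherwise
  \<open>X\<close> acts like a nimber \<open>*n\<close> with \<open>n\<close> tending to infinity, and then every sum of \<open>X\<close> with an
  affine impartial form is an \<open>\<N>\<close>-position, as for the moon.\<close>

section \<open>Conjugation and sums\<close>

lemma plus_game_commute: "plus_game G H = plus_game H G"
proof (induction G H rule: plus_game.induct)
  case (7 GL GR HL HR)
  have "(\<lambda>g. plus_game g (Form HL HR)) |`| A = plus_game (Form HL HR) |`| A"
    if "A = GL \<or> A = GR" for A
    using that 7(1,3) by (intro fset.map_cong0) auto
  moreover have "plus_game (Form GL GR) |`| A = (\<lambda>h. plus_game h (Form GL GR)) |`| A"
    if "A = HL \<or> A = HR" for A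
    using that 7(2,4) by (intro fset.map_cong0) auto
  ultimately show ?case
    by (simp add: funion_commute)
qed simp_all

lemma conjugate_conjugate [simp]: "conjugate (conjugate G) = G"
proof (induction G rule: conjugate.induct)
  case (3 GL GR)
  have "(\<lambda>x. conjugate (conjugate x)) |`| A = A" if "A = GL \<or> A = GR" for A
  proof -
    have "(\<lambda>x. conjugate (conjugate x)) |`| A = (\<lambda>x. x) |`| A"
      using that 3 by (intro fset.map_cong0) auto
    then show ?thesis by simp
  qed
  then show ?case
    by (simp add: fset.map_comp comp_def)
qed simp_all

lemma conjugate_eq_infinity [simp]:
  "conjugate G = \<infinity> \<longleftrightarrow> G = \<infinity>\<^sub>R" "conjugate G = \<infinity>\<^sub>R \<longleftrightarrow> G = \<infinity>"
  by (cases G; simp)+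

lemma size_conjugate [simp]: "size (conjugate G) = size G"
proof (induction G rule: conjugate.induct)
  case (3 GL GR)
  have inj: "inj_on conjugate S" for S
    by (metis conjugate_conjugate inj_onI)
  have "(\<Sum>x\<in>conjugate ` fset A. Suc (size x)) = (\<Sum>x\<in>fset A. Suc (size x))"
    if "A = GL \<or> A = GR" for A
    using that 3 by (auto simp: sum.reindex[OF inj] intro!: sum.cong)
  then show ?case
    by simp
qed simp_all

lemma size_option:
  assumes "g |\<in>| left_opts G \<or> g |\<in>| right_opts G"
  shows "size g < size G"
proof (cases G)
  case (Form GL GR)
  with assms show ?thesis
    using size_member_fset[of g GL] size_member_fset[of g GR] by auto
qed (use assms in auto)

text \<open>The hypotheses exclude the sum of opposite infinities in either order:
  \<open>undefined\<close> need not commute with \<open>conjugate\<close>.\<close>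

lemma conjugate_plus_game:
  assumes "G \<noteq> \<infinity> \<or> H \<noteq> \<infinity>\<^sub>R" "G \<noteq> \<infinity>\<^sub>R \<or> H \<noteq> \<infinity>"
  shows "conjugate (plus_game G H) = plus_game (conjugate G) (conjugate H)"
  using assms
proof (induction G H rule: plus_game.induct)
  case (7 GL GR HL HR)
  have "(\<lambda>g. conjugate (plus_game g (Form HL HR))) |`| A
      = (\<lambda>g. plus_game (conjugate g) (conjugate (Form HL HR))) |`| A"
    if "A = GL \<or> A = GR" for A
    using that 7(1,3) by (intro fset.map_cong0) auto
  moreover have "(\<lambda>h. conjugate (plus_game (Form GL GR) h)) |`| A
      = (\<lambda>h. plus_game (conjugate (Form GL GR)) (conjugate h)) |`| A"
    if "A = HL \<or> A = HR" for A
    using that 7(2,4) by (intro fset.map_cong0) auto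
  ultimately show ?case
    by (simp add: fset.map_comp comp_def fimage_funion)
qed simp_all

lemma left_right_wins_first_conjugate:
  "left_wins_first (conjugate G) = right_wins_first G
   \<and> right_wins_first (conjugate G) = left_wins_first G"
  by (induction G rule: conjugate.induct) auto

lemmas left_wins_first_conjugate = left_right_wins_first_conjugate[THEN conjunct1]

lemma symmetric_conjugate:
  assumes "symmetric G"
  shows "conjugate G = G"
proof (cases G)
  case (Form GL GR)
  with assms show ?thesis
    by (simp add: symmetric_def fset.map_comp comp_def)
qed (use assms in \<open>auto simp: symmetric_def\<close>)

lemma left_check_conjugate: "left_check (conjugate G) = right_check G"
proof (cases G)
  case (Form GL GR)
  have "\<infinity> |\<in>| conjugate |`| GR \<longleftrightarrow> \<infinity>\<^sub>R |\<in>| GR"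
    by (metis conjugate.simps(2) conjugate_eq_infinity(1) fimageE fimageI)
  with Form show ?thesis
    by (simp add: left_check_def right_check_def)
qed (simp_all add: left_check_def right_check_def)

lemma quiet_conjugate: "quiet (conjugate G) = quiet G"
  using left_check_conjugate[of G] left_check_conjugate[of "conjugate G"]
  by (auto simp: quiet_def)

section \<open>Winning moves in a sum, and checks\<close>

lemma left_opts_plus_game:
  assumes "G \<notin> {\<infinity>, \<infinity>\<^sub>R}" "H \<notin> {\<infinity>, \<infinity>\<^sub>R}"
  shows "left_opts (plus_game G H)
    = (\<lambda>g. plus_game g H) |`| left_opts G |\<union>| plus_game G |`| left_opts H"
    and "plus_game G H \<notin> {\<infinity>, \<infinity>\<^sub>R}"
  using assms by (cases G; cases H; simp)+

lemma left_wins_first_iff: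
  assumes "G \<notin> {\<infinity>, \<infinity>\<^sub>R}"
  shows "left_wins_first G \<longleftrightarrow> (\<exists>g |\<in>| left_opts G. \<not> right_wins_first g)"
  using assms by (cases G) auto

text \<open>Conjugating the position after Left's move turns Right to move into Left to move, so the
  recursion needs only \<open>left_wins_first\<close>. By symmetry \<open>H\<close> absorbs its
  conjugation; \<open>G\<close> may be an asymmetric check and appears conjugated.\<close>

lemma left_wins_first_plus:
  assumes "G \<notin> {\<infinity>, \<infinity>\<^sub>R}" "H \<notin> {\<infinity>, \<infinity>\<^sub>R}" "symmetric H"
  shows "left_wins_first (plus_game G H) \<longleftrightarrow>
    (\<exists>g |\<in>| left_opts G. \<not> left_wins_first (plus_game (conjugate g) H)) \<or>
    (\<exists>h |\<in>| left_opts H. \<not> left_wins_first (plus_game (conjugate h) (conjugate G)))"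
proof -
  have "right_wins_first (plus_game g H) = left_wins_first (plus_game (conjugate g) H)" for g
    using assms conjugate_plus_game[of g H] symmetric_conjugate[of H]
    by (metis insertCI left_wins_first_conjugate)
  moreover have "right_wins_first (plus_game G h)
      = left_wins_first (plus_game (conjugate h) (conjugate G))" for h
    using assms conjugate_plus_game[of h G]
    by (metis insertCI left_wins_first_conjugate plus_game_commute)
  ultimately show ?thesis
    using left_opts_plus_game[OF assms(1,2)] by (auto simp: left_wins_first_iff)
qed

lemma left_check_wins_first:
  assumes "left_check G" "H \<noteq> \<infinity>\<^sub>R"
  shows "left_wins_first (plus_game G H)"
proof (cases "H = \<infinity>")
  case True
  then show ?thesis using assms by (cases G) (auto simp: left_check_def)
next
  case False
  have "plus_game \<infinity> H = \<infinity>"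
    using assms(2) by (cases H) auto
  then have "\<infinity> |\<in>| left_opts (plus_game G H)"
    using assms False left_opts_plus_game(1)[of G H]
    by (metis (no_types, lifting) funionI1 insertE left_check_def rev_fimage_eqI singletonD)
  then show ?thesis
    using assms False left_opts_plus_game(2)[of G H]
    by (auto simp: left_check_def left_wins_first_iff intro!: bexI[of _ "\<infinity>"])
qed

lemma symmetric_not_quiet_left_check:
  assumes "symmetric G" "\<not> quiet G"
  shows "left_check G"
  using assms left_check_conjugate[of G] symmetric_conjugate[of G]
  by (auto simp: quiet_def symmetric_def)

section \<open>Symmetry of quiet followers\<close>

text \<open>The condition of \<open>Im_inf\<close> on quiet followers as a recursion, so that
  options inherit it for the induction on sums. Checks and infinities need not be symmetric
  themselves.\<close>

function quiet_symmetric :: "game \<Rightarrow> bool" where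
  "quiet_symmetric G \<longleftrightarrow> (quiet G \<longrightarrow> symmetric G)
    \<and> (\<forall>g |\<in>| left_opts G |\<union>| right_opts G. quiet_symmetric g)"
  by auto
termination by (relation "measure size") (auto simp: size_option)

declare quiet_symmetric.simps [simp del]

lemma quiet_symmetric_option:
  assumes "quiet_symmetric G" "g |\<in>| left_opts G \<or> g |\<in>| right_opts G"
  shows "quiet_symmetric g"
  using assms quiet_symmetric.simps[of G] by auto

lemma quiet_symmetric_conjugate:
  "quiet_symmetric G \<Longrightarrow> quiet_symmetric (conjugate G)"
proof (induction G rule: measure_induct_rule[where f = size])
  case (less G)
  have "quiet_symmetric (conjugate g)" if "g |\<in>| left_opts G \<or> g |\<in>| right_opts G" for g
    using that less size_option quiet_symmetric_option by blast
  moreover have "left_opts (conjugate G) = conjugate |`| right_opts G"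
    "right_opts (conjugate G) = conjugate |`| left_opts G"
    by (cases G; simp)+
  moreover have "quiet (conjugate G) \<longrightarrow> symmetric (conjugate G)"
    using less.prems quiet_symmetric.simps[of G] by (metis quiet_conjugate symmetric_conjugate)
  ultimately show ?case
    by (subst quiet_symmetric.simps) auto
qed

lemma follower_trans: "follower H K \<Longrightarrow> follower G H \<Longrightarrow> follower G K"
  by (induction rule: follower.induct) (auto intro: follower.intros)

lemma quiet_symmetric_if_followers:
  "(\<And>H. follower G H \<Longrightarrow> quiet H \<Longrightarrow> symmetric H) \<Longrightarrow> quiet_symmetric G"
proof (induction G rule: measure_induct_rule[where f = size])
  case (less G)
  have "quiet_symmetric g" if "g |\<in>| left_opts G \<or> g |\<in>| right_opts G" for g
  proof (rule less.IH)
    show "size g < size G" using that by (rule size_option)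
    have "follower G g" using that follower.intros by blast
    then show "symmetric H" if "follower g H" "quiet H" for H
      using that less.prems follower_trans by blast
  qed
  then show ?case
    using less.prems follower.self by (subst quiet_symmetric.simps) auto
qed

lemma Im_infD:
  assumes "G \<in> Im_inf"
  shows "symmetric G" "quiet_symmetric G"
  using assms by (auto simp: Im_inf_def intro: quiet_symmetric_if_followers)

section \<open>Nimbers and quiet summands\<close>

lemma conjugate_nimber [simp]: "conjugate (nimber n) = nimber n"
proof (induction n rule: less_induct)
  case (less n)
  have "conjugate |`| nimber |`| fset_of_list [0..<n] = nimber |`| fset_of_list [0..<n]"
    unfolding fset.map_comp using less by (intro fset.map_cong0) (auto simp: fset_of_list_elem)
  then show ?case
    by (subst (1 2) nimber.simps) (simp add: zero_game_def)
qed

lemma nimber_not_infinity [simp]: "nimber n \<noteq> \<infinity>" "nimber n \<noteq> \<infinity>\<^sub>R"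
  "\<infinity> \<noteq> nimber n" "\<infinity>\<^sub>R \<noteq> nimber n"
  by (subst nimber.simps; simp add: zero_game_def)+

lemma symmetric_nimber: "symmetric (nimber n)"
proof -
  obtain GL GR where "nimber n = Form GL GR"
    by (cases "nimber n") auto
  then show ?thesis
    using conjugate_nimber[of n] by (auto simp: symmetric_def)
qed

lemma mem_left_opts_nimber:
  "g |\<in>| left_opts (nimber n) \<longleftrightarrow> (if n = 0 then g = \<infinity>\<^sub>R else \<exists>m<n. g = nimber m)"
  by (subst nimber.simps) (auto simp: zero_game_def fset_of_list_elem image_iff)

lemma quiet_nimber: "quiet (nimber n)"
proof -
  have "\<not> left_check (nimber n)"
    by (simp add: left_check_def mem_left_opts_nimber)
  then show ?thesis
    using left_check_conjugate[of "nimber n"] by (simp add: quiet_def)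
qed

text \<open>The option \<open>\<infinity>\<^sub>R\<close> of \<open>nimber 0\<close> is never a
  winning move for Left, which matches the empty range \<open>m<n\<close> at \<open>n = 0\<close>;
  zero thus needs no separate case.\<close>

lemma left_wins_first_plus_nimber:
  assumes "G \<notin> {\<infinity>, \<infinity>\<^sub>R}"
  shows "left_wins_first (plus_game G (nimber n)) \<longleftrightarrow>
    (\<exists>g |\<in>| left_opts G. \<not> left_wins_first (plus_game (conjugate g) (nimber n))) \<or>
    (\<exists>m<n. \<not> left_wins_first (plus_game (conjugate G) (nimber m)))"
proof -
  have "left_wins_first (plus_game \<infinity> (conjugate G))"
    using assms by (cases G) auto
  then have "(\<exists>h |\<in>| left_opts (nimber n).
      \<not> left_wins_first (plus_game (conjugate h) (conjugate G))) \<longleftrightarrow>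
    (\<exists>m<n. \<not> left_wins_first (plus_game (conjugate G) (nimber m)))"
    by (auto simp: mem_left_opts_nimber Bex_def plus_game_commute[of "nimber _"])
  then show ?thesis
    using left_wins_first_plus[OF assms _ symmetric_nimber] by simp
qed

text \<open>Right threatens to finish in \<open>H\<close>. A move of Left in the quiet
  \<open>X\<close> cannot reach \<infinity>, so Right then carries out the threat and wins; Left has
  to answer in \<open>H\<close>.\<close>

lemma left_wins_first_plus_right_check:
  assumes "right_check H" "\<not> left_check H" "quiet X" "symmetric X"
  shows "left_wins_first (plus_game H X) \<longleftrightarrow>
    (\<exists>g |\<in>| left_opts H. \<not> left_wins_first (plus_game (conjugate g) X))"
proof -
  have "left_wins_first (plus_game (conjugate h) (conjugate H))" if "h |\<in>| left_opts X" for h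
  proof -
    have "h \<noteq> \<infinity>" using that assms(3) by (auto simp: quiet_def left_check_def)
    then show ?thesis
      using left_check_wins_first[of "conjugate H" "conjugate h"] assms(1)
      by (simp add: left_check_conjugate plus_game_commute)
  qed
  then show ?thesis
    using left_wins_first_plus[of H X] assms by (auto simp: right_check_def quiet_def)
qed

section \<open>The nimbers that a form acts like\<close>

text \<open>For \<open>i < j\<close>, the first player in X + *j can move to X + *i, which wins if X
  + *i is lost for the player to move.\<close>

lemma P_nimber_unique:
  assumes "symmetric X" "\<not> left_wins_first (plus_game X (nimber m))"
    "\<not> left_wins_first (plus_game X (nimber n))"
  shows "m = n"
proof -
  have "False" if "i < j" "\<not> left_wins_first (plus_game X (nimber i))"
    "\<not> left_wins_first (plus_game X (nimber j))" for i j
    using that assms(1) left_wins_first_plus_nimber[of X j] symmetric_conjugate[of X]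
    by (auto simp: symmetric_def)
  then show ?thesis
    using assms(2,3) by (metis linorder_neqE_nat)
qed

text \<open>A filter treats both kinds of \<open>X\<close> uniformly. For symmetric
  \<open>X\<close>, "eventually" means at the unique n with X + *n a \<P>-position or, if there is
  none, for all large n.\<close>

definition nim_filter :: "game \<Rightarrow> nat filter" where
  "nim_filter X = (if \<exists>n. \<not> left_wins_first (plus_game X (nimber n))
    then principal {n. \<not> left_wins_first (plus_game X (nimber n))} else sequentially)"

lemma nim_filter_P:
  assumes "symmetric X" "\<not> left_wins_first (plus_game X (nimber n))"
  shows "nim_filter X = principal {n}"
proof -
  have "{k. \<not> left_wins_first (plus_game X (nimber k))} = {n}"
    using assms P_nimber_unique by blast
  then show ?thesis using assms(2) unfolding nim_filter_def by auto
qed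

lemma nim_filter_no_P:
  "(\<And>n. left_wins_first (plus_game X (nimber n))) \<Longrightarrow> nim_filter X = sequentially"
  by (simp add: nim_filter_def)

lemma nim_filter_neq_bot: "nim_filter X \<noteq> bot"
  by (auto simp: nim_filter_def principal_eq_bot_iff)

lemma eventually_left_wins_first_plus_nimber:
  assumes "symmetric H"
  shows "eventually (\<lambda>n. left_wins_first (plus_game H (nimber n))) sequentially"
proof (cases "\<exists>m. \<not> left_wins_first (plus_game H (nimber m))")
  case True
  then obtain m where "\<not> left_wins_first (plus_game H (nimber m))" by blast
  then show ?thesis
    using P_nimber_unique[OF assms]
    by (intro eventually_sequentiallyI[of "Suc m"]) (metis not_less_eq_eq order_refl)
qed simp

section \<open>Replacing a quiet summand by nimbers\<close>

text \<open>The induction step for two quiet summands. \<open>HL\<close> and \<open>XL\<close> play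
  the role of induction hypotheses: moves in each summand are judged against the nimbers of the
  other.\<close>

lemma left_wins_first_plus_quiet:
  assumes "quiet H" "symmetric H" "quiet X" "symmetric X"
    and HL: "\<And>g. g |\<in>| left_opts H \<Longrightarrow> \<forall>\<^sub>F n in nim_filter X.
      left_wins_first (plus_game (conjugate g) (nimber n))
      = left_wins_first (plus_game (conjugate g) X)"
    and XL: "\<And>g. g |\<in>| left_opts X \<Longrightarrow> \<forall>\<^sub>F n in nim_filter H.
      left_wins_first (plus_game (conjugate g) (nimber n))
      = left_wins_first (plus_game (conjugate g) H)"
  shows "\<forall>\<^sub>F n in nim_filter X.
      left_wins_first (plus_game H (nimber n)) = left_wins_first (plus_game H X)"
proof -
  define win where "win Y n \<longleftrightarrow> left_wins_first (plus_game Y (nimber n))" for Y n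
  define opt where "opt Y n \<longleftrightarrow>
    (\<exists>g |\<in>| left_opts Y. \<not> left_wins_first (plus_game (conjugate g) (nimber n)))" for Y n
  have forms: "H \<notin> {\<infinity>, \<infinity>\<^sub>R}" "X \<notin> {\<infinity>, \<infinity>\<^sub>R}"
    using assms by (auto simp: quiet_def)
  have win_H: "win H n \<longleftrightarrow> opt H n \<or> (\<exists>m<n. \<not> win H m)" for n
    using left_wins_first_plus_nimber[of H n] forms symmetric_conjugate[OF assms(2)]
    by (simp add: win_def opt_def)
  have win_X: "win X n \<longleftrightarrow> opt X n \<or> (\<exists>m<n. \<not> win X m)" for n
    using left_wins_first_plus_nimber[of X n] forms symmetric_conjugate[OF assms(4)]
    by (simp add: win_def opt_def)
  have sum: "left_wins_first (plus_game H X) \<longleftrightarrow>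
    (\<exists>g |\<in>| left_opts H. \<not> left_wins_first (plus_game (conjugate g) X)) \<or>
    (\<exists>g |\<in>| left_opts X. \<not> left_wins_first (plus_game (conjugate g) H))"
    using left_wins_first_plus[OF forms assms(4)] symmetric_conjugate[OF assms(2)] by simp
  have evH: "\<forall>\<^sub>F n in nim_filter X. opt H n \<longleftrightarrow>
      (\<exists>g |\<in>| left_opts H. \<not> left_wins_first (plus_game (conjugate g) X))"
  proof -
    have "\<forall>\<^sub>F n in nim_filter X. \<forall>g |\<in>| left_opts H.
        left_wins_first (plus_game (conjugate g) (nimber n))
        = left_wins_first (plus_game (conjugate g) X)"
      using HL by (intro eventually_ball_finite) auto
    then show ?thesis
      by (rule eventually_mono) (auto simp: opt_def)
  qed
  have evX: "\<forall>\<^sub>F n in nim_filter H. opt X n \<longleftrightarrow>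
      (\<exists>g |\<in>| left_opts X. \<not> left_wins_first (plus_game (conjugate g) H))"
  proof -
    have "\<forall>\<^sub>F n in nim_filter H. \<forall>g |\<in>| left_opts X.
        left_wins_first (plus_game (conjugate g) (nimber n))
        = left_wins_first (plus_game (conjugate g) H)"
      using XL by (intro eventually_ball_finite) auto
    then show ?thesis
      by (rule eventually_mono) (auto simp: opt_def)
  qed
  have "\<forall>\<^sub>F n in nim_filter X. win H n = left_wins_first (plus_game H X)"
  proof (cases "\<exists>b. \<not> win X b")
    \<comment> \<open>No smaller nimber is a winning target, so every X + *n is won by a move in
      \<open>X\<close>. As \<open>nim_filter H\<close> is nontrivial, \<open>evX\<close> yields a
      winning move in \<open>X\<close> also against \<open>H\<close>. On the nimber side, H + *n is
      won for all large n.\<close>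
    case False
    then have "opt X n" for n
      using win_X by blast
    then have "left_wins_first (plus_game H X)"
      using evX nim_filter_neq_bot[of H] sum eventually_happens'[of "nim_filter H"] by auto
    then show ?thesis
      using False eventually_left_wins_first_plus_nimber[OF assms(2)] nim_filter_no_P[of X]
      by (simp add: win_def)
  next
    case True
    then obtain b where b: "\<not> win X b" by blast
    then have FX: "nim_filter X = principal {b}"
      using nim_filter_P[OF assms(4)] by (simp add: win_def)
    have "win H b = left_wins_first (plus_game H X)"
    proof (cases "\<exists>a. \<not> win H a")
      \<comment> \<open>Likewise H + *b is won by a move in \<open>H\<close>, and \<open>evH\<close>
        at \<open>b\<close> carries this over to \<open>X\<close>.\<close>
      case False
      then have "opt H n" for n
        using win_H by blast
      then show ?thesis
        using False evH sum FX by (auto simp: eventually_principal)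
    next
      case True
      then obtain a where a: "\<not> win H a" by blast
      then have FH: "nim_filter H = principal {a}"
        using nim_filter_P[OF assms(2)] by (simp add: win_def)
      have "left_wins_first (plus_game H X) \<longleftrightarrow> opt H b \<or> opt X a"
        using evH evX sum FX FH by (auto simp: eventually_principal)
      moreover have "win X m \<longleftrightarrow> m \<noteq> b" "win H m \<longleftrightarrow> m \<noteq> a" for m
        using a b P_nimber_unique assms(2,4) unfolding win_def by blast+
      \<comment> \<open>If \<open>a = b\<close>, both \<open>opt H b\<close> and
        \<open>opt X a\<close> fail. If \<open>b < a\<close>, the win in H + *b can only come from
        \<open>opt H b\<close>; if \<open>a < b\<close>, the win in X + *a only from
        \<open>opt X a\<close>.\<close>
      ultimately show ?thesis
        using win_H[of b] win_X[of a] by (metis linorder_neqE_nat less_asym)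
    qed
    then show ?thesis
      using FX by (simp add: eventually_principal)
  qed
  then show ?thesis
    by (simp add: win_def)
qed

text \<open>Induction on the total size, with both games arbitrary because the quiet case exchanges
  their roles. \<open>H\<close> may be an infinity or an asymmetric check, as these arise within
  entailing sequences.\<close>

lemma left_wins_first_plus_eventually_nimber:
  assumes "quiet_symmetric H" "quiet_symmetric X" "quiet X"
  shows "\<forall>\<^sub>F n in nim_filter X.
    left_wins_first (plus_game H (nimber n)) = left_wins_first (plus_game H X)"
  using assms
proof (induction "size H + size X" arbitrary: H X rule: less_induct)
  case less
  have symX: "symmetric X"
    using less.prems quiet_symmetric.simps[of X] by blast
  have HL: "\<forall>\<^sub>F n in nim_filter X. left_wins_first (plus_game (conjugate g) (nimber n))
      = left_wins_first (plus_game (conjugate g) X)" if "g |\<in>| left_opts H" for g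
    using that less.prems size_option[of g H]
    by (intro less.hyps) (auto intro: quiet_symmetric_conjugate quiet_symmetric_option)
  consider "H \<in> {\<infinity>, \<infinity>\<^sub>R}" | "left_check H" | "right_check H" "\<not> left_check H" | "quiet H"
    by (auto simp: quiet_def)
  then show ?case
  proof cases
    case 1
    have "plus_game H Y = H" if "quiet Y" for Y
      using 1 that by (cases Y) (auto simp: quiet_def)
    then show ?thesis
      using less.prems quiet_nimber by simp
  next
    case 2
    then show ?thesis
      using left_check_wins_first[of H] less.prems by (simp add: quiet_def)
  next
    case 3
    \<comment> \<open>Left must answer in \<open>H\<close> against \<open>X\<close> and against
      every nimber; the finitely many equalities from \<open>HL\<close> hold simultaneously and
      decide both sides.\<close>
    have "\<forall>\<^sub>F n in nim_filter X. \<forall>g |\<in>| left_opts H.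
        left_wins_first (plus_game (conjugate g) (nimber n))
        = left_wins_first (plus_game (conjugate g) X)"
      using HL by (intro eventually_ball_finite) auto
    then show ?thesis
      by (rule eventually_mono)
        (simp add: left_wins_first_plus_right_check[OF 3] quiet_nimber symmetric_nimber
          less.prems symX)
  next
    case 4
    have symH: "symmetric H"
      using 4 less.prems quiet_symmetric.simps[of H] by blast
    \<comment> \<open>Here the quiet \<open>H\<close> takes the place of \<open>X\<close>, and the
      conjugated option of \<open>X\<close> that of \<open>H\<close>; conjugation keeps the
      size.\<close>
    have "\<forall>\<^sub>F n in nim_filter H. left_wins_first (plus_game (conjugate g) (nimber n))
        = left_wins_first (plus_game (conjugate g) H)" if "g |\<in>| left_opts X" for g
      using that less.prems 4 size_option[of g X]
      by (intro less.hyps) (auto intro: quiet_symmetric_conjugate quiet_symmetric_option)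
    then show ?thesis
      using left_wins_first_plus_quiet[OF 4 symH less.prems(3) symX] HL by blast
  qed
qed

section \<open>Outcomes of symmetric sums and the classification\<close>

text \<open>The sum is its own conjugate, so both players fare alike when moving first.\<close>

lemma outcome_plus_symmetric:
  assumes "symmetric G" "symmetric X"
  shows "outcome (plus_game G X) = (if left_wins_first (plus_game G X) then \<N> else \<P>)"
proof -
  have "conjugate (plus_game G X) = plus_game G X"
    using assms conjugate_plus_game[of G X] symmetric_conjugate by (auto simp: symmetric_def)
  then show ?thesis
    using left_wins_first_conjugate[of "plus_game G X"] by (simp add: outcome_def)
qed

lemma eq_Im_infI:
  assumes "symmetric G" "symmetric H"
    "\<And>X. X \<in> Im_inf \<Longrightarrow> left_wins_first (plus_game G X) = left_wins_first (plus_game H X)"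
  shows "G =\<^sub>I\<^sub>m H"
  using assms Im_infD(1) by (simp add: eq_Im_inf_def outcome_plus_symmetric)

lemma symmetric_moon: "symmetric moon"
  by (simp add: symmetric_def moon_def)

lemma left_check_moon: "left_check moon"
  by (simp add: left_check_def moon_def)

theorem theorem3p20:
  fixes G :: game
  assumes "G \<in> Im_inf"
  shows "(\<exists>n. G =\<^sub>I\<^sub>m nimber n) \<or> G =\<^sub>I\<^sub>m moon"
proof -
  note G = Im_infD[OF assms]
  \<comment> \<open>\<open>moon\<close> is a check, so the first player wins its sum with any form
    of \<open>Im_inf\<close>; it suffices that \<open>G\<close> does the same.\<close>
  have moonI: "G =\<^sub>I\<^sub>m moon" if "\<And>X. X \<in> Im_inf \<Longrightarrow> left_wins_first (plus_game G X)"
    using that left_check_wins_first[OF left_check_moon] Im_infD(1)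
    by (intro eq_Im_infI[OF G(1) symmetric_moon]) (auto simp: symmetric_def)
  show ?thesis
  proof (cases "quiet G")
    case False
    then have "left_check G"
      using G symmetric_not_quiet_left_check by blast
    then show ?thesis
      using moonI left_check_wins_first Im_infD(1) by (auto simp: symmetric_def)
  next
    case True
    \<comment> \<open>\<open>X\<close> may be a check, so the quiet \<open>G\<close> is the summand
      to replace by nimbers.\<close>
    have ev: "\<forall>\<^sub>F n in nim_filter G.
        left_wins_first (plus_game X (nimber n)) = left_wins_first (plus_game G X)"
      if "X \<in> Im_inf" for X
      using left_wins_first_plus_eventually_nimber[OF _ G(2) True] Im_infD(2)[OF that]
      by (simp add: plus_game_commute[of G])
    show ?thesis
    proof (cases "\<exists>n. \<not> left_wins_first (plus_game G (nimber n))")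
      case True
      then obtain n where "nim_filter G = principal {n}"
        using nim_filter_P[OF G(1)] by blast
      then have "G =\<^sub>I\<^sub>m nimber n"
        using ev by (intro eq_Im_infI[OF G(1) symmetric_nimber])
          (simp add: eventually_principal plus_game_commute[of "nimber n"])
      then show ?thesis by blast
    next
      case False
      then have F: "nim_filter G = sequentially"
        using nim_filter_no_P by blast
      have "left_wins_first (plus_game G X)" if X: "X \<in> Im_inf" for X
      proof -
        \<comment> \<open>For large n the sum of \<open>X\<close> and *n is a first-player win and
          agrees with the sum of \<open>G\<close> and \<open>X\<close>, which does not depend on
          n.\<close>
        have "\<forall>\<^sub>F n in sequentially. left_wins_first (plus_game G X)"
          using ev[OF X] eventually_left_wins_first_plus_nimber[OF Im_infD(1)[OF X]]
          unfolding F by eventually_elim simp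
        then show ?thesis by simp
      qed
      then show ?thesis using moonI by blast
    qed
  qed
qed

end
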